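(* Let $\alpha,\beta\in(0,1]$. The symmetric Green's function for the homogeneous problem $$D^{\beta}D^{\alpha}D^{\beta}D^{\alpha}x(t)=0$$ with the Lidstone-type boundary conditions $$x(0)=0=D^{\beta}D^{\alpha}x(0),\qquad x(1)=0=D^{\beta}D^{\alpha}x(1)$$ is, for $t,s\in[0,1]$, $$G(t,s)=\begin{cases}u(t,s) & : t\le s,\\ u(s,t) & : s\le t,\end{cases}$$ where $$u(t,s)=\frac{t^{\alpha}}{\alpha\beta(\alpha+\beta)(2\alpha+\beta)}\left[2\alpha s^{\alpha}(1-s^{\beta})-\beta(1-s^{\alpha})\left(t^{\alpha+\beta}+s^{\alpha+\beta}\right)\right].$$ That is, $G(t,s)=G(s,t)$, and for every continuous function $h$ on $[0,1]$ the function $x(t)=\int_0^1G(t,s)h(s)s^{\beta-1}\,ds$ is a solution of $D^{\beta}D^{\alpha}D^{\beta}D^{\alpha}x(t)=h(t)$ on $[0,1]$ satisfying these boundary conditions.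
   Context: For $\alpha\in(0,1]$ the conformable fractional derivative of order $\alpha$ of a function $f$ is $D^{\alpha}f(t):=\lim_{\varepsilon\to0}\frac{f(te^{\varepsilon t^{-\alpha}})-f(t)}{\varepsilon}$ for $t>0$, and $D^{\alpha}f(0):=\lim_{t\to0^+}D^{\alpha}f(t)$; if $f$ is differentiable at $t>0$ then $D^{\alpha}f(t)=t^{1-\alpha}f'(t)$. For functions on $[0,1]$ the derivative at $t=1$ is one-sided. Iterated symbols such as $D^{\beta}D^{\alpha}x$ mean $D^{\beta}(D^{\alpha}x)$. The term "Green's function" is meant in the sense spelled out in the claim (kernel of the solution operator with respect to the weight $s^{\beta-1}\,ds$, where $\beta$ is the order of the outermost derivative). *)

theory Defs
  imports "HOL-Analysis.Analysis"
begin

text \<open>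
  Everything below concerns functions on the unit interval, represented as total functions on the
  reals of which only the values on \<open>{0..1}\<close> matter. For \<open>t > 0\<close>, the increment \<open>\<epsilon>\<close> in the difference
  quotient is restricted to those values that keep the argument of \<open>f\<close> inside \<open>{0..1}\<close>; for
  \<open>0 < t < 1\<close> this does not affect the two-sided limit, and for \<open>t = 1\<close> it yields the one-sided one.
\<close>

definition conf_quot :: "real \<Rightarrow> (real \<Rightarrow> real) \<Rightarrow> real \<Rightarrow> real \<Rightarrow> real" where
  "conf_quot \<alpha> f t \<epsilon> = (f (t * exp (\<epsilon> * t powr (- \<alpha>))) - f t) / \<epsilon>"

definition conf_at :: "real \<Rightarrow> real \<Rightarrow> real filter" where
  "conf_at \<alpha> t = at 0 within {\<epsilon>. t * exp (\<epsilon> * t powr (- \<alpha>)) \<in> {0..1}}"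

definition conf_deriv_pos :: "real \<Rightarrow> (real \<Rightarrow> real) \<Rightarrow> real \<Rightarrow> real" where
  "conf_deriv_pos \<alpha> f t = Lim (conf_at \<alpha> t) (conf_quot \<alpha> f t)"

definition conf_deriv :: "real \<Rightarrow> (real \<Rightarrow> real) \<Rightarrow> real \<Rightarrow> real" where
  "conf_deriv \<alpha> f t =
     (if t = 0 then Lim (at_right 0) (conf_deriv_pos \<alpha> f) else conf_deriv_pos \<alpha> f t)"

text \<open>
  \<open>Lim\<close> is total, so the existence of all the limits involved in \<open>conf_deriv \<alpha> f\<close> on \<open>{0..1}\<close>
  (including the one at \<open>0\<close>) is expressed separately.
\<close>

definition conf_differentiable :: "real \<Rightarrow> (real \<Rightarrow> real) \<Rightarrow> bool" where
  "conf_differentiable \<alpha> f \<longleftrightarrow>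
     (\<forall>t\<in>{0<..1}. \<exists>L. (conf_quot \<alpha> f t \<longlongrightarrow> L) (conf_at \<alpha> t)) \<and>
     (\<exists>L. (conf_deriv_pos \<alpha> f \<longlongrightarrow> L) (at_right 0))"

definition solves_conf_eq :: "real \<Rightarrow> real \<Rightarrow> (real \<Rightarrow> real) \<Rightarrow> (real \<Rightarrow> real) \<Rightarrow> bool" where
  "solves_conf_eq \<alpha> \<beta> h x \<longleftrightarrow>
     conf_differentiable \<alpha> x \<and>
     conf_differentiable \<beta> (conf_deriv \<alpha> x) \<and>
     conf_differentiable \<alpha> (conf_deriv \<beta> (conf_deriv \<alpha> x)) \<and>
     conf_differentiable \<beta> (conf_deriv \<alpha> (conf_deriv \<beta> (conf_deriv \<alpha> x))) \<and>
     (\<forall>t\<in>{0..1}. conf_deriv \<beta> (conf_deriv \<alpha> (conf_deriv \<beta> (conf_deriv \<alpha> x))) t = h t)"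

definition lidstone_bc :: "real \<Rightarrow> real \<Rightarrow> (real \<Rightarrow> real) \<Rightarrow> bool" where
  "lidstone_bc \<alpha> \<beta> x \<longleftrightarrow>
     x 0 = 0 \<and> conf_deriv \<beta> (conf_deriv \<alpha> x) 0 = 0 \<and>
     x 1 = 0 \<and> conf_deriv \<beta> (conf_deriv \<alpha> x) 1 = 0"

definition green_u :: "real \<Rightarrow> real \<Rightarrow> real \<Rightarrow> real \<Rightarrow> real" where
  "green_u \<alpha> \<beta> t s =
     t powr \<alpha> / (\<alpha> * \<beta> * (\<alpha> + \<beta>) * (2 * \<alpha> + \<beta>)) *
     (2 * \<alpha> * s powr \<alpha> * (1 - s powr \<beta>)
      - \<beta> * (1 - s powr \<alpha>) * (t powr (\<alpha> + \<beta>) + s powr (\<alpha> + \<beta>)))"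

definition green :: "real \<Rightarrow> real \<Rightarrow> real \<Rightarrow> real \<Rightarrow> real" where
  "green \<alpha> \<beta> t s = (if t \<le> s then green_u \<alpha> \<beta> t s else green_u \<alpha> \<beta> s t)"

end

theory Submission
  imports Defs
begin

text \<open>
  Each branch of the kernel is a sum of two products of a function of \<open>t\<close> and a function of \<open>s\<close>, so
  the proposed solution has the form
  \<open>x(t) = A(t) \<integral>\<^sub>0\<^sup>t P h w + B(t) \<integral>\<^sub>0\<^sup>t Q h w + P(t) \<integral>\<^sub>t\<^sup>1 A h w + Q(t) \<integral>\<^sub>t\<^sup>1 B h w\<close>
  with \<open>P(t) = t\<^sup>\<alpha>\<close>, \<open>Q(t) = t\<^sup>2\<^sup>\<alpha>\<^sup>+\<^sup>\<beta>\<close> and weight \<open>w(s) = s\<^sup>\<beta>\<^sup>-\<^sup>1\<close>. The four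
  coefficients in front of the integrals solve the homogeneous equation. Differentiating such an
  expression is variation of parameters: besides the terms in which the coefficients are
  differentiated, the moving end points contribute \<open>h w\<close> times the jump of the kernel across
  \<open>t = s\<close> (\<open>split_int_has_derivative\<close>). The kernel and its first two successive conformable
  derivatives in \<open>t\<close> are continuous across the diagonal, so in the first three steps only the
  coefficients are differentiated (\<open>conf_C1_split_int\<close>). After three steps the coefficients are
  constants and the jump is \<open>1\<close>; the fourth derivative \<open>D\<^sup>\<beta> = t\<^sup>1\<^sup>-\<^sup>\<beta> d/dt\<close> cancels the weight and
  leaves \<open>h\<close>.

  All functions met on the way have conformable derivatives that are given on \<open>(0,1]\<close> by a formula
  continuous up to \<open>0\<close>. For such functions the conformable derivative at \<open>0\<close>, which is defined as a
  limit, is simply the value of that formula (\<open>conf_C1_imp_conf_deriv\<close>), so the boundary conditions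
  are read off by substituting \<open>t = 0\<close> and \<open>t = 1\<close>.
\<close>

section \<open>Continuously conformable differentiable functions\<close>

text \<open>
  Here \<open>g\<close> is the conformable derivative of \<open>f\<close>, expressed through \<open>f' = t\<^sup>\<gamma>\<^sup>-\<^sup>1 g\<close>, and continuity of
  \<open>g\<close> on the closed interval takes care of the limit at \<open>0\<close>. No ordinary derivative of \<open>f\<close> at
  \<open>0\<close> is asked for: \<open>t\<^sup>\<gamma>\<close> with \<open>0 < \<gamma> < 1\<close> has none.
\<close>
definition conf_C1 :: "real \<Rightarrow> (real \<Rightarrow> real) \<Rightarrow> (real \<Rightarrow> real) \<Rightarrow> bool" where
  "conf_C1 \<gamma> f g \<longleftrightarrow> continuous_on {0..1} g \<and>
     (\<forall>t\<in>{0<..1}. (f has_real_derivative t powr (\<gamma> - 1) * g t) (at t within {0..1}))"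

text \<open>
  Uniqueness of limits along this filter needs it to be proper even at \<open>t = 1\<close>; negative
  increments are always admissible because they move the argument to the left.
\<close>
lemma conf_at_neq_bot:
  assumes "0 < t" "t \<le> 1"
  shows "conf_at \<gamma> t \<noteq> bot"
proof -
  have sub: "{..<0} \<subseteq> {\<epsilon>. t * exp (\<epsilon> * t powr (- \<gamma>)) \<in> {0..1}}"
  proof
    fix \<epsilon> :: real assume "\<epsilon> \<in> {..<0}"
    then have "\<epsilon> * t powr (- \<gamma>) \<le> 0" by (simp add: mult_nonpos_nonneg)
    then have "t * exp (\<epsilon> * t powr (- \<gamma>)) \<le> 1 * 1" using assms by (intro mult_mono) auto
    then show "\<epsilon> \<in> {\<epsilon>. t * exp (\<epsilon> * t powr (- \<gamma>)) \<in> {0..1}}" using assms by simp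
  qed
  show ?thesis
    unfolding conf_at_def using at_le[OF sub, of "0::real"] trivial_limit_at_left_real[of "0::real"]
    by (auto simp: bot_unique)
qed

text \<open>
  The conformable quotient of \<open>f\<close> at \<open>t\<close> is the ordinary difference quotient at \<open>0\<close> of
  \<open>f \<circ> k\<close> with \<open>k(\<epsilon>) = t e\<^sup>\<epsilon>\<^sup>u\<close>, \<open>u = t\<^sup>-\<^sup>\<gamma>\<close>. Since \<open>k'(0) = t\<^sup>1\<^sup>-\<^sup>\<gamma>\<close>, the chain rule applies, and it
  may be used relative to \<open>{0..1}\<close> so that \<open>t = 1\<close> is covered as well.
\<close>
lemma conf_quot_tendsto:
  assumes "conf_C1 \<gamma> f g" "0 < t" "t \<le> 1"
  shows "(conf_quot \<gamma> f t \<longlongrightarrow> g t) (conf_at \<gamma> t)"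
proof -
  define k where "k = (\<lambda>\<epsilon>. t * exp (\<epsilon> * t powr (- \<gamma>)))"
  define S where "S = {\<epsilon>. k \<epsilon> \<in> {0..1}}"
  have k0: "k 0 = t" by (simp add: k_def)
  have f: "(f has_real_derivative t powr (\<gamma> - 1) * g t) (at (k 0) within k ` S)"
    unfolding k0
  proof (rule DERIV_subset)
    show "(f has_real_derivative t powr (\<gamma> - 1) * g t) (at t within {0..1})"
      using assms by (simp add: conf_C1_def)
  qed (auto simp: S_def)
  have k: "(k has_real_derivative t * t powr (- \<gamma>)) (at 0 within S)"
    unfolding k_def by (auto intro!: derivative_eq_intros)
  have "t powr (\<gamma> - 1) * g t * (t * t powr (- \<gamma>)) = g t"
    using assms by (simp add: powr_diff powr_minus field_simps)
  with DERIV_image_chain[OF f k]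
  have "(f \<circ> k has_real_derivative g t) (at 0 within S)" by simp
  then show ?thesis
    unfolding has_field_derivative_iff conf_quot_def[abs_def] conf_at_def S_def k_def by simp
qed

text \<open>
  The conclusion is about any \<open>f'\<close> agreeing with \<open>f\<close> on the interval: \<open>conf_deriv\<close> is a total
  function known only there, and this form lets the lemma be applied to its own output in order to
  iterate derivatives. The admissible increments never leave the interval, so agreement there is
  enough.
\<close>
lemma conf_C1_imp_conf_deriv:
  assumes "conf_C1 \<gamma> f g" and eq: "\<And>t. t \<in> {0..1} \<Longrightarrow> f' t = f t"
  shows "conf_differentiable \<gamma> f'" and "\<And>t. t \<in> {0..1} \<Longrightarrow> conf_deriv \<gamma> f' t = g t"
proof -
  have lim: "(conf_quot \<gamma> f' t \<longlongrightarrow> g t) (conf_at \<gamma> t)" if "t \<in> {0<..1}" for t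
  proof -
    have "(conf_quot \<gamma> f t \<longlongrightarrow> g t) (conf_at \<gamma> t)"
      using conf_quot_tendsto[OF assms(1)] that by simp
    moreover have "\<forall>\<^sub>F \<epsilon> in conf_at \<gamma> t. conf_quot \<gamma> f t \<epsilon> = conf_quot \<gamma> f' t \<epsilon>"
      unfolding conf_at_def eventually_at_filter using that
      by (auto simp: conf_quot_def eq intro!: always_eventually)
    ultimately show ?thesis by (rule Lim_transform_eventually)
  qed
  have pos: "conf_deriv_pos \<gamma> f' t = g t" if "t \<in> {0<..1}" for t
    unfolding conf_deriv_pos_def using that lim[OF that] conf_at_neq_bot by (intro tendsto_Lim) auto
  have "(g \<longlongrightarrow> g 0) (at 0 within {0..1})"
    using assms(1) by (auto simp: conf_C1_def continuous_on_def)
  then have "(g \<longlongrightarrow> g 0) (at_right 0)"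
    by (simp add: at_within_Icc_at_right)
  moreover have "\<forall>\<^sub>F t in at_right 0. g t = conf_deriv_pos \<gamma> f' t"
    unfolding eventually_at_right_field using pos by (intro exI[of _ 1]) auto
  ultimately have zero: "(conf_deriv_pos \<gamma> f' \<longlongrightarrow> g 0) (at_right 0)"
    by (rule Lim_transform_eventually)
  show "conf_differentiable \<gamma> f'"
    unfolding conf_differentiable_def using lim zero by blast
  show "conf_deriv \<gamma> f' t = g t" if "t \<in> {0..1}" for t
    using that pos[of t] tendsto_Lim[OF _ zero] by (auto simp: conf_deriv_def)
qed

text \<open>
  Lets the derivative be computed by the rules below and compared with the desired expression
  afterwards.
\<close>
lemma conf_C1_eq: "conf_C1 \<gamma> f g' \<Longrightarrow> g' = g \<Longrightarrow> conf_C1 \<gamma> f g"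
  by simp

lemma conf_C1_const: "conf_C1 \<gamma> (\<lambda>_. c) (\<lambda>_. 0)"
  by (auto simp: conf_C1_def)

lemma conf_C1_add:
  "conf_C1 \<gamma> f f' \<Longrightarrow> conf_C1 \<gamma> g g' \<Longrightarrow> conf_C1 \<gamma> (\<lambda>t. f t + g t) (\<lambda>t. f' t + g' t)"
  unfolding conf_C1_def by (auto intro!: continuous_intros derivative_eq_intros simp: algebra_simps)

lemma conf_C1_cmult:
  "conf_C1 \<gamma> f f' \<Longrightarrow> conf_C1 \<gamma> (\<lambda>t. c * f t) (\<lambda>t. c * f' t)"
  unfolding conf_C1_def by (auto intro!: continuous_intros derivative_eq_intros simp: algebra_simps)

lemma has_real_derivative_powr_conf:
  assumes "0 < (t::real)"
  shows "((\<lambda>t. t powr r) has_real_derivative t powr (\<gamma> - 1) * (r * t powr (r - \<gamma>))) (at t within S)"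
proof -
  have "t powr (\<gamma> - 1) * (r * t powr (r - \<gamma>)) = r * t powr (r - 1)"
    using assms by (simp add: powr_add[symmetric])
  then show ?thesis
    using has_field_derivative_at_within[OF has_real_derivative_powr[OF assms, of r], of S]
    by (simp only:)
qed

text \<open>
  The exponent \<open>\<gamma>\<close> is separate because \<open>0 powr 0 = 0\<close>: the expression \<open>\<gamma> * t powr (\<gamma> - \<gamma>)\<close> would be
  discontinuous at \<open>0\<close> for \<open>\<gamma> \<noteq> 0\<close>, whereas the constant \<open>\<gamma>\<close> is not.
\<close>
lemma conf_C1_powr_same: "conf_C1 \<gamma> (\<lambda>t. t powr \<gamma>) (\<lambda>_. \<gamma>)"
  using has_real_derivative_powr_conf[of _ \<gamma> \<gamma>] by (auto simp: conf_C1_def)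

lemma conf_C1_powr_greater:
  assumes "\<gamma> < r"
  shows "conf_C1 \<gamma> (\<lambda>t. t powr r) (\<lambda>t. r * t powr (r - \<gamma>))"
  unfolding conf_C1_def using assms
  by (auto intro!: continuous_intros continuous_on_powr' has_real_derivative_powr_conf)

section \<open>Weighted primitives\<close>

definition wint :: "real \<Rightarrow> (real \<Rightarrow> real) \<Rightarrow> (real \<Rightarrow> real) \<Rightarrow> real \<Rightarrow> real" where
  "wint \<beta> h q t = integral {0..t} (\<lambda>s. q s * h s * s powr (\<beta> - 1))"

text \<open>
  For \<open>\<beta> < 1\<close> the weight is unbounded at \<open>0\<close>, but it is nonnegative and has a finite integral;
  the product of an absolutely integrable function and a bounded measurable one is again absolutely
  integrable.
\<close>
lemma weighted_integrable:
  assumes "0 < \<beta>" "continuous_on {0..1} f"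
  shows "(\<lambda>s. f s * s powr (\<beta> - 1)) integrable_on {0..1::real}"
proof -
  have "(\<lambda>s::real. s powr (\<beta> - 1)) absolutely_integrable_on {0..1}"
    using integrable_on_powr_from_0[of "\<beta> - 1" 1] assms
    by (intro nonnegative_absolutely_integrable_1) auto
  then have "(\<lambda>s. f s * s powr (\<beta> - 1)) absolutely_integrable_on {0..1}"
    using assms(2)
    by (intro absolutely_integrable_bounded_measurable_product_real
        continuous_imp_measurable_on_sets_lebesgue compact_imp_bounded compact_continuous_image) auto
  then show ?thesis
    by (simp add: absolutely_integrable_on_def)
qed

context
  fixes \<beta> :: real and h q :: "real \<Rightarrow> real"
  assumes beta: "0 < \<beta>" and h: "continuous_on {0..1} h" and q: "continuous_on {0..1} q"
begin

lemma wint_integrable: "(\<lambda>s. q s * h s * s powr (\<beta> - 1)) integrable_on {0..1}"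
  using weighted_integrable[OF beta, of "\<lambda>s. q s * h s"] h q by (auto intro: continuous_intros)

lemma wint_continuous: "continuous_on {0..1} (wint \<beta> h q)"
  unfolding wint_def[abs_def] using indefinite_integral_continuous_1[OF wint_integrable] .

lemma wint_has_derivative:
  assumes "t \<in> {0<..1}"
  shows "(wint \<beta> h q has_real_derivative q t * h t * t powr (\<beta> - 1)) (at t within {0..1})"
proof -
  have "continuous (at t within {0..1}) (\<lambda>s. q s * h s * s powr (\<beta> - 1))"
    using assms h q
    by (intro continuous_intros) (auto simp: continuous_on_eq_continuous_within)
  then show ?thesis
    using integral_has_vector_derivative_continuous_at[OF wint_integrable, of t "{}"] assms
    by (simp add: wint_def[abs_def] has_real_derivative_iff_has_vector_derivative)
qed

end

lemma wint_0: "wint \<beta> h q 0 = 0"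
  by (simp add: wint_def)

section \<open>Variation of parameters\<close>

text \<open>
  The integral over \<open>{0..1}\<close>, against \<open>h\<close> and the weight, of the kernel with value
  \<open>p1 t * q1 s + p2 t * q2 s\<close> for \<open>s \<le> t\<close> and \<open>p3 t * q3 s + p4 t * q4 s\<close> for \<open>t \<le> s\<close>. The functions
  of \<open>s\<close> come first since they stay fixed under differentiation in \<open>t\<close>. The integral from \<open>t\<close>
  to \<open>1\<close> is a difference of two integrals from \<open>0\<close>, so that one differentiation rule
  serves both kinds.
\<close>
definition split_int ::
  "real \<Rightarrow> (real \<Rightarrow> real) \<Rightarrow> (real \<Rightarrow> real) \<Rightarrow> (real \<Rightarrow> real) \<Rightarrow> (real \<Rightarrow> real) \<Rightarrow> (real \<Rightarrow> real) \<Rightarrow>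
   (real \<Rightarrow> real) \<Rightarrow> (real \<Rightarrow> real) \<Rightarrow> (real \<Rightarrow> real) \<Rightarrow> (real \<Rightarrow> real) \<Rightarrow> real \<Rightarrow> real"
  where
  "split_int \<beta> h q1 q2 q3 q4 p1 p2 p3 p4 t =
     p1 t * wint \<beta> h q1 t + p2 t * wint \<beta> h q2 t +
     p3 t * (wint \<beta> h q3 1 - wint \<beta> h q3 t) + p4 t * (wint \<beta> h q4 1 - wint \<beta> h q4 t)"

context
  fixes \<beta> \<gamma> :: real and h q1 q2 q3 q4 p1 p2 p3 p4 p1' p2' p3' p4' :: "real \<Rightarrow> real"
  assumes beta: "0 < \<beta>" and h: "continuous_on {0..1} h"
    and q: "continuous_on {0..1} q1" "continuous_on {0..1} q2"
      "continuous_on {0..1} q3" "continuous_on {0..1} q4"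
    and p: "conf_C1 \<gamma> p1 p1'" "conf_C1 \<gamma> p2 p2'" "conf_C1 \<gamma> p3 p3'" "conf_C1 \<gamma> p4 p4'"
begin

lemma split_int_continuous: "continuous_on {0..1} (split_int \<beta> h q1 q2 q3 q4 p1' p2' p3' p4')"
  using p unfolding split_int_def[abs_def] conf_C1_def
  by (auto intro!: continuous_intros wint_continuous beta h q)

text \<open>
  The product rule, with the contributions of the moving end points collected into the jump of the
  kernel at \<open>s = t\<close>. The order \<open>\<gamma>\<close> of differentiation need not match the order \<open>\<beta>\<close> in the weight.
\<close>
lemma split_int_has_derivative:
  assumes t: "t \<in> {0<..1}"
  shows "(split_int \<beta> h q1 q2 q3 q4 p1 p2 p3 p4 has_real_derivative
      t powr (\<gamma> - 1) * split_int \<beta> h q1 q2 q3 q4 p1' p2' p3' p4' t +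
      (p1 t * q1 t + p2 t * q2 t - p3 t * q3 t - p4 t * q4 t) * h t * t powr (\<beta> - 1))
    (at t within {0..1})"
proof -
  note dp = p[unfolded conf_C1_def, THEN conjunct2, rule_format, OF t]
  note dw = q[THEN wint_has_derivative[OF beta h _ t]]
  show ?thesis
    unfolding split_int_def[abs_def]
    by (rule derivative_eq_intros dp dw refl)+ (simp add: algebra_simps)
qed

text \<open>
  When the two branches agree on the diagonal the jump vanishes, and what remains of the derivative
  is \<open>t\<^sup>\<gamma>\<^sup>-\<^sup>1\<close> times a function continuous up to \<open>0\<close>.
\<close>
lemma conf_C1_split_int:
  assumes "\<And>t. t \<in> {0<..1} \<Longrightarrow> p1 t * q1 t + p2 t * q2 t = p3 t * q3 t + p4 t * q4 t"
  shows "conf_C1 \<gamma> (split_int \<beta> h q1 q2 q3 q4 p1 p2 p3 p4)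
    (split_int \<beta> h q1 q2 q3 q4 p1' p2' p3' p4')"
  unfolding conf_C1_def
proof (intro conjI ballI)
  fix t :: real assume t: "t \<in> {0<..1}"
  have "p1 t * q1 t + p2 t * q2 t - p3 t * q3 t - p4 t * q4 t = 0"
    using assms[OF t] by simp
  with split_int_has_derivative[OF t]
  show "(split_int \<beta> h q1 q2 q3 q4 p1 p2 p3 p4 has_real_derivative
      t powr (\<gamma> - 1) * split_int \<beta> h q1 q2 q3 q4 p1' p2' p3' p4' t) (at t within {0..1})"
    by simp
qed (rule split_int_continuous)

end

lemma integral_split_kernel:
  assumes beta: "0 < \<beta>" and h: "continuous_on {0..1} h"
    and q: "continuous_on {0..1} q1" "continuous_on {0..1} q2"
      "continuous_on {0..1} q3" "continuous_on {0..1} q4"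
    and t: "t \<in> {0..1}"
    and below: "\<And>s. s \<in> {0..t} \<Longrightarrow> K s = p1 t * q1 s + p2 t * q2 s"
    and above: "\<And>s. s \<in> {t..1} \<Longrightarrow> K s = p3 t * q3 s + p4 t * q4 s"
  shows "((\<lambda>s. K s * h s * s powr (\<beta> - 1)) has_integral
      split_int \<beta> h q1 q2 q3 q4 p1 p2 p3 p4 t) {0..1}"
proof -
  define \<phi> where "\<phi> = (\<lambda>q s. q s * h s * s powr (\<beta> - 1))"
  have int: "\<phi> q integrable_on {0..1}" if "continuous_on {0..1} q" for q
    unfolding \<phi>_def using wint_integrable[OF beta h that] .
  have left: "(\<phi> q has_integral wint \<beta> h q t) {0..t}" if "continuous_on {0..1} q" for q
  proof -
    have "(\<phi> q has_integral integral {0..t} (\<phi> q)) {0..t}"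
      using t by (intro integrable_integral integrable_on_subinterval[OF int[OF that]]) auto
    then show ?thesis by (simp add: wint_def \<phi>_def)
  qed
  have right: "(\<phi> q has_integral (wint \<beta> h q 1 - wint \<beta> h q t)) {t..1}"
    if "continuous_on {0..1} q" for q
  proof -
    have "wint \<beta> h q t + integral {t..1} (\<phi> q) = wint \<beta> h q 1"
      using Henstock_Kurzweil_Integration.integral_combine[OF _ _ int[OF that], of t] t
      by (simp add: wint_def \<phi>_def)
    moreover have "(\<phi> q has_integral integral {t..1} (\<phi> q)) {t..1}"
      using t by (intro integrable_integral integrable_on_subinterval[OF int[OF that]]) auto
    moreover from calculation have "integral {t..1} (\<phi> q) = wint \<beta> h q 1 - wint \<beta> h q t"
      by linarith
    ultimately show ?thesis by simp
  qed
  have "(\<phi> K has_integral p1 t * wint \<beta> h q1 t + p2 t * wint \<beta> h q2 t) {0..t}"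
    by (rule has_integral_eq[OF _ has_integral_add[OF left[OF q(1), THEN has_integral_mult_right]
          left[OF q(2), THEN has_integral_mult_right]]])
      (simp add: \<phi>_def below algebra_simps)
  moreover have "(\<phi> K has_integral p3 t * (wint \<beta> h q3 1 - wint \<beta> h q3 t) +
      p4 t * (wint \<beta> h q4 1 - wint \<beta> h q4 t)) {t..1}"
    by (rule has_integral_eq[OF _ has_integral_add[OF right[OF q(3), THEN has_integral_mult_right]
          right[OF q(4), THEN has_integral_mult_right]]])
      (simp add: \<phi>_def above algebra_simps)
  ultimately have "(\<phi> K has_integral (p1 t * wint \<beta> h q1 t + p2 t * wint \<beta> h q2 t) +
      (p3 t * (wint \<beta> h q3 1 - wint \<beta> h q3 t) + p4 t * (wint \<beta> h q4 1 - wint \<beta> h q4 t))) {0..1}"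
    using t by (intro has_integral_combine[of 0 t 1]) auto
  then show ?thesis
    by (simp add: \<phi>_def split_int_def algebra_simps)
qed

section \<open>The Green's function\<close>

lemma green_symmetric: "green \<alpha> \<beta> t s = green \<alpha> \<beta> s t"
  by (auto simp: green_def)

lemma powr_double: "t powr (2 * \<alpha>) = t powr \<alpha> * t powr \<alpha>" for t \<alpha> :: real
  by (simp only: mult_2 powr_add)

theorem theorem4p3:
  fixes \<alpha> \<beta> :: real
  assumes "0 < \<alpha>" "\<alpha> \<le> 1" "0 < \<beta>" "\<beta> \<le> 1"
  shows "(\<forall>t\<in>{0..1}. \<forall>s\<in>{0..1}. green \<alpha> \<beta> t s = green \<alpha> \<beta> s t) \<and>
    (\<forall>h :: real \<Rightarrow> real. continuous_on {0..1} h \<longrightarrow>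
       (\<forall>t\<in>{0..1}. (\<lambda>s. green \<alpha> \<beta> t s * h s * s powr (\<beta> - 1)) integrable_on {0..1}) \<and>
       solves_conf_eq \<alpha> \<beta> h
         (\<lambda>t. integral {0..1} (\<lambda>s. green \<alpha> \<beta> t s * h s * s powr (\<beta> - 1))) \<and>
       lidstone_bc \<alpha> \<beta>
         (\<lambda>t. integral {0..1} (\<lambda>s. green \<alpha> \<beta> t s * h s * s powr (\<beta> - 1))))"
proof (intro conjI ballI allI impI)
  show "green \<alpha> \<beta> t s = green \<alpha> \<beta> s t" for t s
    by (rule green_symmetric)
next
  fix h :: "real \<Rightarrow> real" assume h: "continuous_on {0..1} h"
  \<comment> \<open>The kernel is \<open>A(t) P(s) + B(t) Q(s)\<close> for \<open>s \<le> t\<close> and \<open>P(t) A(s) + Q(t) B(s)\<close> for \<open>t \<le> s\<close>.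
    A digit counts how many of \<open>D\<^sup>\<alpha>\<close>, \<open>D\<^sup>\<beta>\<close>, \<open>D\<^sup>\<alpha>\<close> have been applied, in this order.\<close>
  define k where "k = 1 / (\<alpha> * \<beta> * (\<alpha> + \<beta>) * (2 * \<alpha> + \<beta>))"
  define A where "A = (\<lambda>t::real. k * (2 * \<alpha> * t powr \<alpha> +
    (- (2 * \<alpha> + \<beta>) * t powr (\<alpha> + \<beta>) + \<beta> * t powr (2 * \<alpha> + \<beta>))))"
  define A1 where "A1 = (\<lambda>t::real. k * (2 * \<alpha> * \<alpha> +
    (- (2 * \<alpha> + \<beta>) * ((\<alpha> + \<beta>) * t powr \<beta>) + \<beta> * ((2 * \<alpha> + \<beta>) * t powr (\<alpha> + \<beta>)))))"
  define A2 where "A2 = (\<lambda>t::real. k * (- (2 * \<alpha> + \<beta>) * ((\<alpha> + \<beta>) * \<beta>) +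
    \<beta> * ((2 * \<alpha> + \<beta>) * ((\<alpha> + \<beta>) * t powr \<alpha>))))"
  define A3 where "A3 = (\<lambda>t::real. 1::real)"
  define B where "B = (\<lambda>t::real. k * (\<beta> * t powr \<alpha> + - \<beta>))"
  define B1 where "B1 = (\<lambda>t::real. k * (\<beta> * \<alpha>))"
  define P where "P = (\<lambda>t::real. t powr \<alpha>)"
  define P1 where "P1 = (\<lambda>t::real. \<alpha>)"
  define Q where "Q = (\<lambda>t::real. t powr (2 * \<alpha> + \<beta>))"
  define Q1 where "Q1 = (\<lambda>t::real. (2 * \<alpha> + \<beta>) * t powr (\<alpha> + \<beta>))"
  define Q2 where "Q2 = (\<lambda>t::real. (2 * \<alpha> + \<beta>) * ((\<alpha> + \<beta>) * t powr \<alpha>))"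
  define Q3 where "Q3 = (\<lambda>t::real. (2 * \<alpha> + \<beta>) * ((\<alpha> + \<beta>) * \<alpha>))"
  define Z where "Z = (\<lambda>t::real. 0::real)"
  have k: "k * (\<beta> * ((2 * \<alpha> + \<beta>) * ((\<alpha> + \<beta>) * \<alpha>))) = 1"
  proof -
    have "\<alpha> * \<beta> * (\<alpha> + \<beta>) * (2 * \<alpha> + \<beta>) \<noteq> 0"
      using assms by (simp add: add_pos_pos less_imp_neq[symmetric])
    then have "k * (\<alpha> * \<beta> * (\<alpha> + \<beta>) * (2 * \<alpha> + \<beta>)) = 1"
      by (simp add: k_def)
    then show ?thesis by (simp only: mult_ac)
  qed

  have less: "\<alpha> < \<alpha> + \<beta>" "\<alpha> < 2 * \<alpha> + \<beta>" "\<beta> < \<alpha> + \<beta>"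
    using assms by simp_all
  note conf_C1_calc =
    conf_C1_const conf_C1_powr_same less[THEN conf_C1_powr_greater] conf_C1_add conf_C1_cmult
  have dA: "conf_C1 \<alpha> A A1"
    unfolding A_def A1_def
    by (rule conf_C1_eq, (rule conf_C1_calc)+) simp
  have dB: "conf_C1 \<alpha> B B1"
    unfolding B_def B1_def
    by (rule conf_C1_eq, (rule conf_C1_calc)+) simp
  have dP: "conf_C1 \<alpha> P P1"
    unfolding P_def P1_def by (rule conf_C1_powr_same)
  have dQ: "conf_C1 \<alpha> Q Q1"
    unfolding Q_def Q1_def
    by (rule conf_C1_eq, (rule conf_C1_calc)+) simp
  have dA1: "conf_C1 \<beta> A1 A2"
    unfolding A1_def A2_def
    by (rule conf_C1_eq, (rule conf_C1_calc)+) simp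
  have dQ1: "conf_C1 \<beta> Q1 Q2"
    unfolding Q1_def Q2_def
    by (rule conf_C1_eq, (rule conf_C1_calc)+) simp
  have dA2: "conf_C1 \<alpha> A2 A3"
    unfolding A2_def A3_def
    by (rule conf_C1_eq, (rule conf_C1_calc)+) (simp add: k)
  have dQ2: "conf_C1 \<alpha> Q2 Q3"
    unfolding Q2_def Q3_def
    by (rule conf_C1_eq, (rule conf_C1_calc)+) simp
  have dconst: "conf_C1 \<gamma> B1 Z" "conf_C1 \<gamma> P1 Z" "conf_C1 \<gamma> Z Z" "conf_C1 \<gamma> A3 Z" "conf_C1 \<gamma> Q3 Z"
    for \<gamma>
    unfolding B1_def P1_def Z_def A3_def Q3_def by (rule conf_C1_const)+

  have cont: "continuous_on {0..1} P" "continuous_on {0..1} Q" "continuous_on {0..1} A" "continuous_on {0..1} B"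
    unfolding P_def Q_def A_def B_def using assms
    by (auto intro!: continuous_intros continuous_on_powr')
  \<comment> \<open>With all powers expanded into products of \<open>t\<^sup>\<alpha>\<close> and \<open>t\<^sup>\<beta>\<close>, agreement of the two branches on
    the diagonal is a polynomial identity at each of the first three steps.\<close>
  define F where "F = split_int \<beta> h P Q A B"
  note step = conf_C1_split_int[OF assms(3) h cont, folded F_def]
  have 1: "conf_C1 \<alpha> (F A B P Q) (F A1 B1 P1 Q1)"
    by (rule step[OF dA dB dP dQ]) simp
  have 2: "conf_C1 \<beta> (F A1 B1 P1 Q1) (F A2 Z Z Q2)"
    by (rule step[OF dA1 dconst(1,2) dQ1])
      (unfold P_def Q_def A_def B_def A1_def B1_def P1_def Q1_def powr_add powr_double,
        simp add: algebra_simps)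
  have 3: "conf_C1 \<alpha> (F A2 Z Z Q2) (F A3 Z Z Q3)"
    by (rule step[OF dA2 dconst(3,3) dQ2])
      (simp add: P_def B_def A2_def Z_def Q2_def algebra_simps)
  \<comment> \<open>Here the branches no longer agree: the jump \<open>1\<close> is what produces \<open>h\<close>.\<close>
  have 4: "conf_C1 \<beta> (F A3 Z Z Q3) h"
    unfolding conf_C1_def
  proof (intro conjI ballI h)
    fix t :: real assume t: "t \<in> {0<..1}"
    have "A3 t * P t + Z t * Q t - Z t * A t - Q3 t * B t =
        1 - (k * (\<beta> * ((2 * \<alpha> + \<beta>) * ((\<alpha> + \<beta>) * \<alpha>))) - 1) * (P t - 1)"
      by (simp add: A3_def P_def Z_def Q3_def B_def algebra_simps)
    then have "A3 t * P t + Z t * Q t - Z t * A t - Q3 t * B t = 1"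
      by (simp add: k)
    moreover have "F Z Z Z Z t = 0"
      by (simp add: F_def split_int_def Z_def)
    ultimately show "(F A3 Z Z Q3 has_real_derivative t powr (\<beta> - 1) * h t) (at t within {0..1})"
      using split_int_has_derivative[OF assms(3) h cont dconst(4,3,3,5) t, folded F_def, of \<beta>]
      by (simp add: mult.commute)
  qed

  define x where "x = (\<lambda>t. integral {0..1} (\<lambda>s. green \<alpha> \<beta> t s * h s * s powr (\<beta> - 1)))"
  have u: "green_u \<alpha> \<beta> s t = A t * P s + B t * Q s" for s t
  proof -
    have "green_u \<alpha> \<beta> s t = s powr \<alpha> * k * (2 * \<alpha> * t powr \<alpha> * (1 - t powr \<beta>)
        - \<beta> * (1 - t powr \<alpha>) * (s powr (\<alpha> + \<beta>) + t powr (\<alpha> + \<beta>)))"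
      by (simp add: green_u_def k_def)
    then show ?thesis
      unfolding A_def B_def P_def Q_def powr_add powr_double by (simp add: algebra_simps)
  qed
  have G: "((\<lambda>s. green \<alpha> \<beta> t s * h s * s powr (\<beta> - 1)) has_integral F A B P Q t) {0..1}"
    if t: "t \<in> {0..1}" for t
    unfolding F_def using t
    by (intro integral_split_kernel assms h cont) (auto simp: green_def u mult.commute)
  show "(\<lambda>s. green \<alpha> \<beta> t s * h s * s powr (\<beta> - 1)) integrable_on {0..1}" if "t \<in> {0..1}" for t
    using G[OF that] by blast
  have x: "x t = F A B P Q t" if "t \<in> {0..1}" for t
    unfolding x_def using G[OF that] by (rule integral_unique)
  note x1 = conf_C1_imp_conf_deriv[OF 1 x]
  note x2 = conf_C1_imp_conf_deriv[OF 2 x1(2)]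
  note x3 = conf_C1_imp_conf_deriv[OF 3 x2(2)]
  note x4 = conf_C1_imp_conf_deriv[OF 4 x3(2)]
  show "solves_conf_eq \<alpha> \<beta> h x"
    unfolding solves_conf_eq_def using x1 x2 x3 x4 by blast
  have A_ends: "A 0 = 0" "A 1 = 0" "B 1 = 0"
    by (simp_all add: A_def B_def algebra_simps)
  show "lidstone_bc \<alpha> \<beta> x"
    unfolding lidstone_bc_def
    using x[of 0] x[of 1] x2(2)[of 0] x2(2)[of 1]
    by (simp add: F_def split_int_def wint_0 A_ends P_def Q_def A2_def Q2_def Z_def algebra_simps)
qed

end
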